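(* Let $(\mathcal{M},\mathfrak{M})$ be a Luzin measurable space and let $\mathcal{P}$ be a probability measure on $(\mathcal{M},\mathfrak{M})$. For $\mu\in\mathcal{M}$ and $C\in\mathfrak{M}$ let $\mathcal{P}(\mu,C)$ be given such that, for every $\mu\in\mathcal{M}$, $C\mapsto\mathcal{P}(\mu,C)$ is a probability measure on $(\mathcal{M},\mathfrak{M})$, and, for every $C\in\mathfrak{M}$, $\mu\mapsto\mathcal{P}(\mu,C)$ is an $\mathfrak{M}$-measurable function. If, for every $\mu\in\mathcal{M}$, the measure $\mathcal{P}(\mu,\cdot)$ is absolutely continuous with respect to $\mathcal{P}$, then there exists an $\mathfrak{M}\times\mathfrak{M}$-measurable version of the Radon-Nikodym derivative $\frac{\mathcal{P}(\mu,d\nu)}{\mathcal{P}(d\nu)}$.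
   Context: A Luzin measurable space is a measurable space isomorphic to a Borel subset of a Polish space (equivalently, of a compact metric space) equipped with its Borel $\sigma$-algebra, i.e. a standard Borel space. $\mathfrak{M}\times\mathfrak{M}$ denotes the product $\sigma$-algebra on $\mathcal{M}\times\mathcal{M}$. An $\mathfrak{M}\times\mathfrak{M}$-measurable version of the Radon-Nikodym derivative $\frac{\mathcal{P}(\mu,d\nu)}{\mathcal{P}(d\nu)}$ is an $\mathfrak{M}\times\mathfrak{M}$-measurable function $f:\mathcal{M}\times\mathcal{M}\to[0,\infty)$ such that $\mathcal{P}(\mu,A)=\int_A f(\mu,\nu)\,\mathcal{P}(d\nu)$ for every $\mu\in\mathcal{M}$ and every $A\in\mathfrak{M}$. *)

theory Defs
  imports "HOL-Probability.Probability"
begin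

definition borel_of_top :: "'b topology \<Rightarrow> 'b measure" where
  "borel_of_top X = sigma (topspace X) {U. openin X U}"

definition measurable_isomorphic :: "'a measure \<Rightarrow> 'b measure \<Rightarrow> bool" where
  "measurable_isomorphic M N \<longleftrightarrow>
     (\<exists>f\<in>measurable M N. \<exists>g\<in>measurable N M.
        (\<forall>x\<in>space M. g (f x) = x) \<and> (\<forall>y\<in>space N. f (g y) = y))"

text \<open>
  A Luzin measurable space is one that is isomorphic to a Borel subset of a Polish space. HOL
  cannot quantify existentially over the type of points of that Polish space, so the type is an
  explicit parameter. When the predicate is used as a hypothesis with \<open>'b\<close> a free type variable,
  the theorem is universally quantified over \<open>'b\<close>, and hence covers Polish spaces on arbitrary
  carriers. Only the \<open>\<sigma>\<close>-algebra of \<open>M\<close> matters, not its measure.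
\<close>

definition luzin_space :: "'b itself \<Rightarrow> 'a measure \<Rightarrow> bool" where
  "luzin_space _ M \<longleftrightarrow>
     (\<exists>(X :: 'b topology) B.
        completely_metrizable_space X \<and> second_countable X \<and>
        B \<in> sets (borel_of_top X) \<and>
        measurable_isomorphic M (restrict_space (borel_of_top X) B))"

text \<open>
  A jointly measurable version of the Radon--Nikodym derivative of \<open>K \<mu>\<close> with respect to \<open>P\<close>,
  with values in \<open>[0,\<infinity>)\<close>. Since \<open>f\<close> is nonnegative, the integral of \<open>f (\<mu>, \<cdot>)\<close> over \<open>A\<close> is written
  as a nonnegative integral, so that no separate integrability condition is needed.
\<close>

definition RN_version ::
    "'a measure \<Rightarrow> 'a measure \<Rightarrow> ('a \<Rightarrow> 'a measure) \<Rightarrow> ('a \<times> 'a \<Rightarrow> real) \<Rightarrow> bool" where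
  "RN_version M P K f \<longleftrightarrow>
     f \<in> borel_measurable (M \<Otimes>\<^sub>M M) \<and>
     (\<forall>z\<in>space (M \<Otimes>\<^sub>M M). 0 \<le> f z) \<and>
     (\<forall>\<mu>\<in>space M. \<forall>A\<in>sets M.
        emeasure (K \<mu>) A = (\<integral>\<^sup>+\<nu>\<in>A. ennreal (f (\<mu>, \<nu>)) \<partial>P))"

end

theory Submission
  imports Defs
begin

text \<open>
  Pointwise in \<open>\<mu>\<close> the Radon--Nikodym theorem gives a density \<open>h\<^sub>\<mu>\<close> of \<open>K \<mu>\<close> with respect to \<open>P\<close>; the
  whole difficulty is to choose these densities measurably in \<open>\<mu>\<close>. The choice is made in the metric
  space \<open>L\<^sup>1(P)\<close>, which is separable because a Luzin space has a countably generated
  \<open>\<sigma>\<close>-algebra (\<open>luzin_space_countably_generated\<close>, \<open>L1_dense_sequence\<close>).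

  Fix a dense sequence \<open>g\<close> in \<open>L\<^sup>1(P)\<close> and let \<open>i(\<mu>,n)\<close> be the first index with
  \<open>\<parallel>h\<^sub>\<mu> - g\<^bsub>i(\<mu>,n)\<^esub>\<parallel>\<^sub>1 \<le> 2\<^sup>-\<^sup>n\<close>. Then \<open>(\<mu>,\<nu>) \<mapsto> g\<^bsub>i(\<mu>,n)\<^esub>(\<nu>)\<close> is jointly measurable as soon as \<open>i(\<cdot>,n)\<close> is
  measurable, and since the errors are summable these functions converge to \<open>h\<^sub>\<mu>(\<nu>)\<close> for
  \<open>P\<close>-almost every \<open>\<nu>\<close> (\<open>AE_LIMSEQ_of_fast_L1\<close>). So the absolute value of their limit is the version
  sought.

  That \<open>i(\<cdot>,n)\<close> is measurable, although \<open>h\<^sub>\<mu>\<close> was chosen without any regard to \<open>\<mu>\<close>, follows from duality: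
  the \<open>L\<^sup>1\<close>-norm of \<open>k\<close> is the supremum of \<open>\<integral>\<phi> k\<close> over a countable family of bounded
  test functions \<open>\<phi>\<close>, for instance the truncations of the \<open>g\<^sub>j\<close> to \<open>[-1,1]\<close>
  (\<open>L1_norm_le_by_tests\<close>). For \<open>k = h\<^sub>\<mu> - g\<^sub>i\<close> the number \<open>\<integral>\<phi> h\<^sub>\<mu> dP = \<integral>\<phi> dK\<^sub>\<mu>\<close> depends only on the kernel,
  and measurably so.
\<close>

section \<open>Countably generated \<open>\<sigma>\<close>-algebras\<close>

lemma sets_borel_of_top: "sets (borel_of_top X) = sigma_sets (topspace X) {U. openin X U}"
  and space_borel_of_top: "space (borel_of_top X) = topspace X"
  unfolding borel_of_top_def by (auto dest: openin_subset intro!: sets_measure_of space_measure_of)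

lemma borel_of_top_countably_generated:
  assumes "second_countable X"
  shows "\<exists>E. countable E \<and> sets (borel_of_top X) = sigma_sets (topspace X) E"
proof -
  obtain B where B: "countable B" "\<And>V. V \<in> B \<Longrightarrow> openin X V"
    "\<And>U x. openin X U \<Longrightarrow> x \<in> U \<Longrightarrow> \<exists>V\<in>B. x \<in> V \<and> V \<subseteq> U"
    using assms unfolding second_countable_def by metis
  interpret sigma_algebra "topspace X" "sigma_sets (topspace X) B"
    using B(2) openin_subset by (intro sigma_algebra_sigma_sets) blast
  have "sigma_sets (topspace X) {U. openin X U} = sigma_sets (topspace X) B"
  proof (rule sigma_sets_eqI)
    fix U assume "U \<in> {U. openin X U}"
    then have "U = \<Union>{V\<in>B. V \<subseteq> U}"
      using B(3)[of U] by auto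
    moreover have "\<Union>{V\<in>B. V \<subseteq> U} \<in> sigma_sets (topspace X) B"
      using B(1) by (intro countable_Union) (auto intro: countable_subset[of _ B] sigma_sets.Basic)
    ultimately show "U \<in> sigma_sets (topspace X) B"
      by simp
  qed (use B(2) in \<open>auto intro: sigma_sets.Basic\<close>)
  then show ?thesis
    using B(1) sets_borel_of_top by metis
qed

text \<open>
  The isomorphism pulls a countable generator back: every measurable set is the preimage of a
  Borel set, namely of its own preimage under the inverse map, and taking preimages commutes with
  generating \<open>\<sigma>\<close>-algebras.
\<close>

lemma luzin_space_countably_generated:
  assumes "luzin_space TYPE('b) M"
  shows "\<exists>E. countable E \<and> E \<subseteq> Pow (space M) \<and> sets M = sigma_sets (space M) E"
proof -
  obtain X :: "'b topology" and B where X: "second_countable X" "B \<in> sets (borel_of_top X)"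
    and iso: "measurable_isomorphic M (restrict_space (borel_of_top X) B)"
    using assms unfolding luzin_space_def by blast
  let ?N = "restrict_space (borel_of_top X) B"
  obtain f g where f: "f \<in> measurable M ?N" and g: "g \<in> measurable ?N M"
    and gf: "\<And>x. x \<in> space M \<Longrightarrow> g (f x) = x"
    using iso unfolding measurable_isomorphic_def by blast
  obtain E where E: "countable E" "sets (borel_of_top X) = sigma_sets (topspace X) E"
    using borel_of_top_countably_generated[OF X(1)] by blast
  have f': "f \<in> measurable M (borel_of_top X)"
    using f by (simp add: measurable_restrict_space2_iff)
  have fN: "f x \<in> space ?N" if "x \<in> space M" for x
    using f that by (rule measurable_space)
  have "sets M = {f -` A \<inter> space M |A. A \<in> sets (borel_of_top X)}"
  proof safe
    fix A assume A: "A \<in> sets M"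
    have "g -` A \<inter> space ?N \<in> sets (borel_of_top X)"
      using measurable_sets[OF g A] X(2) by (auto simp: sets_restrict_space)
    moreover have "A = f -` (g -` A \<inter> space ?N) \<inter> space M"
      using gf fN sets.sets_into_space[OF A] by auto
    ultimately show "\<exists>C. A = f -` C \<inter> space M \<and> C \<in> sets (borel_of_top X)"
      by blast
  qed (rule measurable_sets[OF f'])
  also have "\<dots> = sigma_sets (space M) {f -` A \<inter> space M |A. A \<in> E}"
    unfolding E(2) using f' by (intro sigma_sets_vimage_commute) (auto simp: measurable_def space_borel_of_top)
  finally have gen: "sets M = sigma_sets (space M) ((\<lambda>A. f -` A \<inter> space M) ` E)"
    by (simp only: Setcompr_eq_image)
  show ?thesis
  proof (intro exI conjI)
    show "countable ((\<lambda>A. f -` A \<inter> space M) ` E)"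
      using E(1) by (rule countable_image)
    show "(\<lambda>A. f -` A \<inter> space M) ` E \<subseteq> Pow (space M)"
      by blast
  qed (rule gen)
qed

lemma countable_Int_stable_generator:
  assumes "countable E" "E \<subseteq> Pow \<Omega>"
  shows "\<exists>E'. countable E' \<and> E' \<subseteq> Pow \<Omega> \<and> Int_stable E' \<and> \<Omega> \<in> E' \<and> sigma_sets \<Omega> E' = sigma_sets \<Omega> E"
proof -
  \<comment> \<open>The intersection of the empty family, cut down to \<open>\<Omega>\<close>, contributes \<open>\<Omega>\<close> itself.\<close>
  define E' where "E' = (\<lambda>F. \<Omega> \<inter> \<Inter>F) ` {F. finite F \<and> F \<subseteq> E}"
  interpret sigma_algebra \<Omega> "sigma_sets \<Omega> E"
    using assms(2) by (rule sigma_algebra_sigma_sets)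
  have "Int_stable E'"
  proof (rule Int_stableI)
    fix a b assume "a \<in> E'" "b \<in> E'"
    then obtain F G where FG: "finite F" "F \<subseteq> E" "finite G" "G \<subseteq> E" "a = \<Omega> \<inter> \<Inter>F" "b = \<Omega> \<inter> \<Inter>G"
      unfolding E'_def by auto
    then have "a \<inter> b = \<Omega> \<inter> \<Inter>(F \<union> G)"
      by auto
    with FG show "a \<inter> b \<in> E'"
      unfolding E'_def by (intro image_eqI[of _ _ "F \<union> G"]) auto
  qed
  moreover have "\<Omega> \<in> E'"
    unfolding E'_def by (intro image_eqI[of _ _ "{}"]) auto
  moreover have "sigma_sets \<Omega> E' = sigma_sets \<Omega> E"
  proof (rule sigma_sets_eqI)
    fix a assume "a \<in> E'"
    then obtain F where F: "finite F" "F \<subseteq> E" "a = \<Omega> \<inter> \<Inter>F"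
      unfolding E'_def by auto
    have "\<Omega> \<inter> \<Inter>F \<in> sigma_sets \<Omega> E"
      using F(1,2)
    proof (induction F)
      case (insert x F)
      then have "\<Omega> \<inter> \<Inter>F \<in> sigma_sets \<Omega> E" and "x \<in> sigma_sets \<Omega> E"
        by (auto intro: sigma_sets.Basic)
      then have "x \<inter> (\<Omega> \<inter> \<Inter>F) \<in> sigma_sets \<Omega> E"
        by (intro Int[of x])
      then show ?case
        by (simp add: Int_left_commute)
    qed (simp add: top)
    with F show "a \<in> sigma_sets \<Omega> E"
      by simp
  next
    fix a assume a: "a \<in> E"
    then have "a = \<Omega> \<inter> \<Inter>{a}"
      using assms(2) by auto
    with a show "a \<in> sigma_sets \<Omega> E'"
      unfolding E'_def by (intro sigma_sets.Basic image_eqI[of _ _ "{a}"]) auto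
  qed
  moreover have "countable E'"
    unfolding E'_def using assms(1) by (intro countable_image countable_Collect_finite_subset)
  moreover have "E' \<subseteq> Pow \<Omega>"
    by (auto simp: E'_def)
  ultimately show ?thesis
    by blast
qed

section \<open>Separability of \<open>L\<^sup>1\<close>\<close>

definition L1_closure :: "'a measure \<Rightarrow> ('a \<Rightarrow> real) set \<Rightarrow> ('a \<Rightarrow> real) set" where
  "L1_closure P G =
     {h. integrable P h \<and> (\<forall>e>0. \<exists>s\<in>G. integrable P s \<and> (\<integral>x. \<bar>h x - s x\<bar> \<partial>P) < e)}"

lemma L1_dist_triangle:
  fixes f g h :: "'a \<Rightarrow> real"
  assumes "integrable P f" "integrable P g" "integrable P h"
  shows "(\<integral>x. \<bar>f x - h x\<bar> \<partial>P) \<le> (\<integral>x. \<bar>f x - g x\<bar> \<partial>P) + (\<integral>x. \<bar>g x - h x\<bar> \<partial>P)"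
proof -
  have "(\<integral>x. \<bar>f x - h x\<bar> \<partial>P) \<le> (\<integral>x. \<bar>f x - g x\<bar> + \<bar>g x - h x\<bar> \<partial>P)"
    using assms by (intro integral_mono) auto
  then show ?thesis
    using assms by simp
qed

lemma L1_closure_closed:
  assumes h: "integrable P h"
    and approx: "\<And>e. e > 0 \<Longrightarrow> \<exists>k\<in>L1_closure P G. (\<integral>x. \<bar>h x - k x\<bar> \<partial>P) < e"
  shows "h \<in> L1_closure P G"
  unfolding L1_closure_def
proof (intro CollectI conjI allI impI h)
  fix e :: real assume "e > 0"
  then obtain k where k: "k \<in> L1_closure P G" "(\<integral>x. \<bar>h x - k x\<bar> \<partial>P) < e / 2"
    using approx[OF half_gt_zero] by blast
  then have "integrable P k"
    by (simp add: L1_closure_def)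
  obtain s where s: "s \<in> G" "integrable P s" "(\<integral>x. \<bar>k x - s x\<bar> \<partial>P) < e / 2"
    using k(1) half_gt_zero[OF \<open>e > 0\<close>] unfolding L1_closure_def by blast
  have "(\<integral>x. \<bar>h x - s x\<bar> \<partial>P) < e"
    using L1_dist_triangle[OF h \<open>integrable P k\<close> s(2)] k(2) s(3) by linarith
  with s show "\<exists>s\<in>G. integrable P s \<and> (\<integral>x. \<bar>h x - s x\<bar> \<partial>P) < e"
    by blast
qed

lemma L1_closure_dominated_limit:
  fixes h w :: "'a \<Rightarrow> real"
  assumes s: "\<And>n::nat. s n \<in> L1_closure P G"
    and h: "integrable P h" and w: "integrable P w"
    and lim: "\<And>x. x \<in> space P \<Longrightarrow> (\<lambda>n. s n x) \<longlonglongrightarrow> h x"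
    and bound: "\<And>n x. x \<in> space P \<Longrightarrow> \<bar>s n x\<bar> \<le> w x"
  shows "h \<in> L1_closure P G"
proof (rule L1_closure_closed[OF h])
  fix e :: real assume "e > 0"
  have [measurable]: "s n \<in> borel_measurable P" "h \<in> borel_measurable P" for n
    using s h by (auto simp: L1_closure_def)
  have "(\<lambda>n. \<integral>x. \<bar>h x - s n x\<bar> \<partial>P) \<longlonglongrightarrow> (\<integral>x. 0 \<partial>P)"
  proof (rule integral_dominated_convergence[where w = "\<lambda>x. \<bar>h x\<bar> + w x"])
    show "AE x in P. (\<lambda>n. \<bar>h x - s n x\<bar>) \<longlonglongrightarrow> 0"
    proof (rule AE_I2)
      fix x assume "x \<in> space P"
      then have "(\<lambda>n. \<bar>h x - s n x\<bar>) \<longlonglongrightarrow> \<bar>h x - h x\<bar>"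
        by (intro tendsto_intros lim)
      then show "(\<lambda>n. \<bar>h x - s n x\<bar>) \<longlonglongrightarrow> 0"
        by simp
    qed
    show "AE x in P. norm \<bar>h x - s n x\<bar> \<le> \<bar>h x\<bar> + w x" for n
    proof (rule AE_I2)
      fix x assume "x \<in> space P"
      then show "norm \<bar>h x - s n x\<bar> \<le> \<bar>h x\<bar> + w x"
        using bound[of x n] by auto
    qed
  qed (use h w in auto)
  then have "(\<lambda>n. \<integral>x. \<bar>h x - s n x\<bar> \<partial>P) \<longlonglongrightarrow> 0"
    by simp
  then have "\<forall>\<^sub>F n in sequentially. (\<integral>x. \<bar>h x - s n x\<bar> \<partial>P) < e"
    using \<open>e > 0\<close> by (rule order_tendstoD)
  then show "\<exists>k\<in>L1_closure P G. (\<integral>x. \<bar>h x - k x\<bar> \<partial>P) < e"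
    using s by (auto simp: eventually_sequentially)
qed

lemma L1_closure_add:
  assumes G: "\<And>s t. s \<in> G \<Longrightarrow> t \<in> G \<Longrightarrow> (\<lambda>x. s x + t x) \<in> G"
    and h: "h \<in> L1_closure P G" and k: "k \<in> L1_closure P G"
  shows "(\<lambda>x. h x + k x) \<in> L1_closure P G"
  unfolding L1_closure_def
proof (intro CollectI conjI allI impI)
  have hk: "integrable P h" "integrable P k"
    using h k by (auto simp: L1_closure_def)
  then show "integrable P (\<lambda>x. h x + k x)"
    by simp
  fix e :: real assume "e > 0"
  then obtain s t where s: "s \<in> G" "integrable P s" "(\<integral>x. \<bar>h x - s x\<bar> \<partial>P) < e / 2"
    and t: "t \<in> G" "integrable P t" "(\<integral>x. \<bar>k x - t x\<bar> \<partial>P) < e / 2"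
    using h k half_gt_zero[OF \<open>e > 0\<close>] unfolding L1_closure_def by blast
  have "(\<integral>x. \<bar>h x + k x - (s x + t x)\<bar> \<partial>P) \<le> (\<integral>x. \<bar>h x - s x\<bar> + \<bar>k x - t x\<bar> \<partial>P)"
    using hk s t by (intro integral_mono) auto
  also have "\<dots> = (\<integral>x. \<bar>h x - s x\<bar> \<partial>P) + (\<integral>x. \<bar>k x - t x\<bar> \<partial>P)"
    using hk s t by simp
  also have "\<dots> < e"
    using s t by simp
  finally show "\<exists>r\<in>G. integrable P r \<and> (\<integral>x. \<bar>h x + k x - r x\<bar> \<partial>P) < e"
    using G[OF s(1) t(1)] s t by (intro bexI[of _ "\<lambda>x. s x + t x"]) auto
qed

text \<open>
  Rational multiples in \<open>G\<close> suffice for real multiples in the closure. This is what allows \<open>G\<close> to be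
  countable.
\<close>

lemma L1_closure_scale:
  assumes G: "\<And>s q. s \<in> G \<Longrightarrow> q \<in> \<rat> \<Longrightarrow> (\<lambda>x. q * s x) \<in> G"
    and h: "h \<in> L1_closure P G"
  shows "(\<lambda>x. c * h x) \<in> L1_closure P G"
  unfolding L1_closure_def
proof (intro CollectI conjI allI impI)
  have ih: "integrable P h"
    using h by (auto simp: L1_closure_def)
  then show "integrable P (\<lambda>x. c * h x)"
    by simp
  fix e :: real assume e: "e > 0"
  \<comment> \<open>Since \<open>ch - qs = c(h - s) - (q - c)s\<close>, first \<open>s\<close> is chosen close to \<open>h\<close> and then \<open>q\<close> close to \<open>c\<close>,
    so that either term has norm at most \<open>e/2\<close>; adding 1 keeps the denominators positive.\<close>
  define d where "d = e / 2 / (\<bar>c\<bar> + 1)"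
  have "d > 0"
    using e by (simp add: d_def)
  then obtain s where s: "s \<in> G" "integrable P s" "(\<integral>x. \<bar>h x - s x\<bar> \<partial>P) < d"
    using h unfolding L1_closure_def by blast
  define S where "S = (\<integral>x. \<bar>s x\<bar> \<partial>P)"
  have "S \<ge> 0"
    by (simp add: S_def)
  obtain q where q: "q \<in> \<rat>" "c < q" "q < c + e / 2 / (S + 1)"
    using Rats_dense_in_real[of c "c + e / 2 / (S + 1)"] e \<open>S \<ge> 0\<close> by auto
  have "(\<integral>x. \<bar>c * h x - q * s x\<bar> \<partial>P) \<le> (\<integral>x. \<bar>c\<bar> * \<bar>h x - s x\<bar> + (q - c) * \<bar>s x\<bar> \<partial>P)"
  proof (intro integral_mono)
    fix x
    have "c * h x - q * s x = c * (h x - s x) - (q - c) * s x"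
      by (simp add: algebra_simps)
    also have "\<bar>\<dots>\<bar> \<le> \<bar>c * (h x - s x)\<bar> + \<bar>(q - c) * s x\<bar>"
      by (rule abs_triangle_ineq4)
    finally show "\<bar>c * h x - q * s x\<bar> \<le> \<bar>c\<bar> * \<bar>h x - s x\<bar> + (q - c) * \<bar>s x\<bar>"
      using q(2) by (simp add: abs_mult)
  qed (use ih s in auto)
  also have "\<dots> = \<bar>c\<bar> * (\<integral>x. \<bar>h x - s x\<bar> \<partial>P) + (q - c) * S"
    using ih s by (simp add: S_def)
  also have "\<dots> \<le> \<bar>c\<bar> * d + (q - c) * S"
    using s(3) by (intro add_right_mono mult_left_mono) auto
  also have "\<dots> < e"
  proof -
    have "\<bar>c\<bar> * d < (\<bar>c\<bar> + 1) * d"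
      using \<open>d > 0\<close> by simp
    also have "\<dots> = e / 2"
      using nonzero_eq_divide_eq[of "\<bar>c\<bar> + 1" d "e / 2"] by (simp add: d_def mult.commute)
    finally have 1: "\<bar>c\<bar> * d < e / 2" .
    have "(q - c) * S \<le> (q - c) * (S + 1)"
      using q(2) by simp
    also have "\<dots> \<le> e / 2 / (S + 1) * (S + 1)"
      using q(3) \<open>S \<ge> 0\<close> by (intro mult_right_mono) auto
    also have "\<dots> = e / 2"
      using nonzero_eq_divide_eq[of "S + 1" "e / 2 / (S + 1)" "e / 2"] \<open>S \<ge> 0\<close> by simp
    finally show ?thesis
      using 1 by simp
  qed
  finally show "\<exists>r\<in>G. integrable P r \<and> (\<integral>x. \<bar>c * h x - r x\<bar> \<partial>P) < e"
    using G[OF s(1) q(1)] s by (intro bexI[of _ "\<lambda>x. q * s x"]) auto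
qed

text \<open>
  Lists make two things immediate: the step functions over a countable set of coefficients and a
  countable family of sets are countably many, and concatenation represents addition.
\<close>

definition step_function :: "(real \<times> 'a set) list \<Rightarrow> 'a \<Rightarrow> real" where
  "step_function l x = (\<Sum>(q, A)\<leftarrow>l. q * indicator A x)"

lemma step_function_simps [simp]:
  "step_function [] x = 0"
  "step_function ((q, A) # l) x = q * indicator A x + step_function l x"
  "step_function (l @ l') x = step_function l x + step_function l' x"
  by (simp_all add: step_function_def)

lemma step_function_scale:
  "step_function (map (\<lambda>(q, A). (c * q, A)) l) x = c * step_function l x"
  by (induction l) (auto simp: algebra_simps)

text \<open>
  The \<open>L\<^sup>1\<close>-closure of the rational step functions over a countable generator is a closed linear
  subspace. The sets whose indicators lie in it therefore form a Dynkin system, so they are all the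
  measurable sets once the generator is stable under intersections; and the indicators span \<open>L\<^sup>1\<close>.
\<close>

lemma L1_dense_sequence:
  assumes P: "finite_measure P" and E: "countable E" "E \<subseteq> Pow (space P)" "sets P = sigma_sets (space P) E"
  shows "\<exists>g :: nat \<Rightarrow> 'a \<Rightarrow> real. (\<forall>i. integrable P (g i)) \<and>
    (\<forall>h e. integrable P h \<longrightarrow> e > 0 \<longrightarrow> (\<exists>i. (\<integral>x. \<bar>h x - g i x\<bar> \<partial>P) < e))"
proof -
  interpret finite_measure P by (rule P)
  obtain D where D: "countable D" "D \<subseteq> Pow (space P)" "Int_stable D" "space P \<in> D"
      "sets P = sigma_sets (space P) D"
    using countable_Int_stable_generator[OF E(1,2)] E(3) by metis
  have D_sets: "A \<in> sets P" if "A \<in> D" for A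
    using that D(5) by (simp add: sigma_sets.Basic)
  define G where "G = step_function ` lists (\<rat> \<times> D)"
  have G_int: "integrable P s" if s: "s \<in> G" for s
  proof -
    obtain l where l: "l \<in> lists (\<rat> \<times> D)" "s = step_function l"
      using s unfolding G_def by blast
    from l(1) have "integrable P (step_function l)"
    proof (induction l)
      case Nil
      then show ?case
        by (simp add: step_function_def)
    next
      case (Cons p l)
      obtain q A where p: "p = (q, A)"
        by (cases p)
      have "integrable P (\<lambda>x. q * indicator A x + step_function l x)"
        using Cons p by (intro Bochner_Integration.integrable_add) (auto simp: emeasure_eq_measure D_sets)
      then show ?case
        by (simp add: p flip: step_function_simps(2))
    qed
    with l(2) show ?thesis by simp
  qed
  have G_add: "(\<lambda>x. s x + t x) \<in> G" if "s \<in> G" "t \<in> G" for s t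
  proof -
    obtain l where "l \<in> lists (\<rat> \<times> D)" "s = step_function l"
      using \<open>s \<in> G\<close> unfolding G_def by blast
    moreover obtain l' where "l' \<in> lists (\<rat> \<times> D)" "t = step_function l'"
      using \<open>t \<in> G\<close> unfolding G_def by blast
    ultimately show ?thesis
      unfolding G_def by (intro image_eqI[of _ _ "l @ l'"]) auto
  qed
  have G_scale: "(\<lambda>x. q * s x) \<in> G" if "s \<in> G" "q \<in> \<rat>" for s q
  proof -
    obtain l where l: "l \<in> lists (\<rat> \<times> D)" "s = step_function l"
      using \<open>s \<in> G\<close> unfolding G_def by blast
    have "map (\<lambda>(r, A). (q * r, A)) l \<in> lists (\<rat> \<times> D)"
      using l(1) that(2) by (induction l) auto
    then show ?thesis
      unfolding G_def l(2) by (intro image_eqI) (auto simp: step_function_scale)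
  qed
  have sum: "(\<lambda>x. h x + k x) \<in> L1_closure P G" if "h \<in> L1_closure P G" "k \<in> L1_closure P G" for h k
    using G_add that by (rule L1_closure_add)
  have scale: "(\<lambda>x. c * h x) \<in> L1_closure P G" if "h \<in> L1_closure P G" for c h
    using G_scale that by (rule L1_closure_scale)
  have G_closure: "G \<subseteq> L1_closure P G"
    unfolding L1_closure_def using G_int by force
  have generator: "indicator A \<in> L1_closure P G" if "A \<in> D" for A
  proof -
    have "step_function [(1, A)] \<in> G"
      unfolding G_def using that by auto
    moreover have "step_function [(1, A)] = indicator A"
      by auto
    ultimately show ?thesis
      using G_closure by auto
  qed
  have zero: "(indicator {} :: 'a \<Rightarrow> real) \<in> L1_closure P G"
  proof -
    have "indicator {} = (\<lambda>x. 0 * indicator (space P) x :: real)"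
      by auto
    then show ?thesis
      using scale[OF generator[OF D(4)], of 0] by (simp only:)
  qed
  have indicator: "(indicator A :: 'a \<Rightarrow> real) \<in> L1_closure P G" if "A \<in> sets P" for A
    using D(3,2) that unfolding D(5)
  proof (induction rule: sigma_sets_induct_disjoint)
    case (basic A)
    then show ?case by (rule generator)
  next
    case empty
    show ?case by (rule zero)
  next
    case (compl A)
    have "A \<subseteq> space P"
      using compl(1) unfolding D(5)[symmetric] by (rule sets.sets_into_space)
    then have "indicator (space P - A) = (\<lambda>x. indicator (space P) x + (-1) * indicator A x :: real)"
      by (auto simp: indicator_def fun_eq_iff)
    then show ?case
      using sum[OF generator[OF D(4)] scale[OF compl(2), of "-1"]] by (simp only:)
  next
    case (union A)
    have A: "A i \<in> sets P" for i
      using union(2) unfolding D(5)[symmetric] by auto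
    have partial: "(indicator (\<Union>i<n. A i) :: 'a \<Rightarrow> real) \<in> L1_closure P G" for n
    proof (induction n)
      case 0
      show ?case
        using zero by (simp only: lessThan_0 SUP_empty)
    next
      case (Suc n)
      have "A n \<inter> A i = {}" if "i < n" for i
        using disjoint_family_onD[OF union(1), of n i] that by simp
      then have "indicator (\<Union>i<Suc n. A i) = (\<lambda>x. indicator (\<Union>i<n. A i) x + indicator (A n) x :: real)"
        by (auto simp: lessThan_Suc indicator_def fun_eq_iff disjoint_iff)
      then show ?case
        using sum[OF Suc union(3)[of n]] by (simp only:)
    qed
    show ?case
    proof (rule L1_closure_dominated_limit[OF partial, where w = "\<lambda>_. 1"])
      show "(\<lambda>n. indicator (\<Union>i<n. A i) x) \<longlonglongrightarrow> (indicator (\<Union>i. A i) x :: real)" for x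
        by (rule LIMSEQ_indicator_UN)
      show "integrable P (indicator (\<Union>i. A i) :: 'a \<Rightarrow> real)"
        using A by (intro integrable_real_indicator) (auto simp: emeasure_eq_measure)
    qed (auto simp: indicator_def)
  qed
  have dense: "h \<in> L1_closure P G" if "integrable P h" for h
    using that
  proof (induction rule: integrable_induct)
    case (base A c)
    then show ?case
      using scale[OF indicator, of A c] by (simp add: mult.commute)
  next
    case (add f g)
    then show ?case
      by (intro sum)
  next
    case (lim f s)
    show ?case
    proof (rule L1_closure_dominated_limit[where s = s and w = "\<lambda>x. 2 * \<bar>f x\<bar>"])
      show "s n \<in> L1_closure P G" for n
        by (rule lim)
      show "integrable P f"
        by (rule lim)
      then show "integrable P (\<lambda>x. 2 * \<bar>f x\<bar>)"
        by simp
      show "(\<lambda>n. s n x) \<longlonglongrightarrow> f x" if "x \<in> space P" for x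
        using that by (rule lim)
      show "\<bar>s n x\<bar> \<le> 2 * \<bar>f x\<bar>" if "x \<in> space P" for n x
        using lim(3)[OF that, of n] by simp
    qed
  qed
  have "countable G"
    unfolding G_def using D(1) countable_rat by (intro countable_image countable_lists countable_SIGMA)
  moreover have "G \<noteq> {}"
    unfolding G_def using lists.Nil by blast
  ultimately have "range (from_nat_into G) = G"
    by (intro range_from_nat_into)
  then obtain g :: "nat \<Rightarrow> 'a \<Rightarrow> real" where g: "range g = G" ..
  show ?thesis
  proof (intro exI[of _ g] conjI allI impI)
    show "integrable P (g i)" for i
      using g by (intro G_int) auto
    show "\<exists>i. (\<integral>x. \<bar>h x - g i x\<bar> \<partial>P) < e" if "integrable P h" "e > 0" for h and e :: real
    proof -
      have "h \<in> L1_closure P (range g)"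
        unfolding g using that(1) by (rule dense)
      with that(2) show ?thesis
        unfolding L1_closure_def by blast
    qed
  qed
qed

section \<open>Almost sure convergence and the \<open>L\<^sup>1\<close>-norm by duality\<close>

text \<open>
  By monotone convergence the series of the errors \<open>\<bar>h - u\<^sub>n\<bar>\<close> has finite integral, hence is
  almost everywhere finite, and then its terms tend to zero.
\<close>

lemma AE_LIMSEQ_of_fast_L1:
  fixes h :: "'a \<Rightarrow> real"
  assumes h: "integrable P h" and u: "\<And>n. integrable P (u n)"
    and fast: "\<And>n. (\<integral>x. \<bar>h x - u n x\<bar> \<partial>P) \<le> (1 / 2) ^ n"
  shows "AE x in P. (\<lambda>n. u n x) \<longlonglongrightarrow> h x"
proof -
  have [measurable]: "h \<in> borel_measurable P" "u n \<in> borel_measurable P" for n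
    using h u by auto
  have "(\<integral>\<^sup>+x. (\<Sum>n. ennreal \<bar>h x - u n x\<bar>) \<partial>P) = (\<Sum>n. \<integral>\<^sup>+x. ennreal \<bar>h x - u n x\<bar> \<partial>P)"
    by (rule nn_integral_suminf) simp
  also have "\<dots> \<le> (\<Sum>n. ennreal ((1 / 2) ^ n))"
    using h u fast by (intro suminf_le) (auto simp: nn_integral_eq_integral ennreal_leI)
  also have "\<dots> = ennreal (\<Sum>n. (1 / 2) ^ n)"
    by (rule suminf_ennreal2) (auto intro: summable_geometric)
  finally have "(\<integral>\<^sup>+x. (\<Sum>n. ennreal \<bar>h x - u n x\<bar>) \<partial>P) \<noteq> \<infinity>"
    by (auto simp: top_unique)
  then have "AE x in P. (\<Sum>n. ennreal \<bar>h x - u n x\<bar>) \<noteq> \<infinity>"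
    by (intro nn_integral_PInf_AE) simp
  then show ?thesis
  proof eventually_elim
    case (elim x)
    then have "summable (\<lambda>n. \<bar>h x - u n x\<bar>)"
      by (intro summable_suminf_not_top) auto
    then have "(\<lambda>n. \<bar>h x - u n x\<bar>) \<longlonglongrightarrow> 0"
      by (rule summable_LIMSEQ_zero)
    then have "(\<lambda>n. h x - (h x - u n x)) \<longlonglongrightarrow> h x - 0"
      by (intro tendsto_diff tendsto_const) (simp only: tendsto_rabs_zero_iff)
    then show ?case by simp
  qed
qed

definition clip :: "real \<Rightarrow> real" where
  "clip t = max (-1) (min 1 t)"

lemma abs_clip_le: "\<bar>clip t\<bar> \<le> 1"
  by (auto simp: clip_def)

lemma clip_sgn: "clip (sgn t) = sgn t"
  by (auto simp: clip_def sgn_if)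

lemma borel_measurable_clip [measurable]: "clip \<in> borel_measurable borel"
  unfolding clip_def by measurable

lemma tendsto_clip: "(u \<longlongrightarrow> l) F \<Longrightarrow> ((\<lambda>n. clip (u n)) \<longlongrightarrow> clip l) F"
  unfolding clip_def by (intro tendsto_intros)

lemma integrable_clip_mult:
  fixes k :: "'a \<Rightarrow> real"
  assumes "integrable P k" "g \<in> borel_measurable P"
  shows "integrable P (\<lambda>x. clip (g x) * k x)"
proof (rule Bochner_Integration.integrable_bound[OF assms(1)])
  show "AE x in P. norm (clip (g x) * k x) \<le> norm (k x)"
    using abs_clip_le by (auto simp: abs_mult mult_left_le_one_le)
qed (use assms in measurable)

text \<open>
  A sequence of the \<open>g j\<close> converging to \<open>sgn k\<close> fast in \<open>L\<^sup>1\<close> converges almost everywhere. Clipping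
  it does not change the limit and makes \<open>\<bar>k\<bar>\<close> a dominating function, so the integrals against \<open>k\<close>
  converge to \<open>\<integral> sgn k \<cdot> k = \<integral>\<bar>k\<bar>\<close>.
\<close>

lemma L1_norm_le_by_tests:
  fixes g :: "nat \<Rightarrow> 'a \<Rightarrow> real"
  assumes P: "finite_measure P" and g: "\<And>i. integrable P (g i)"
    and dense: "\<And>h e. integrable P h \<Longrightarrow> e > 0 \<Longrightarrow> \<exists>i. (\<integral>x. \<bar>h x - g i x\<bar> \<partial>P) < e"
    and k: "integrable P k" and tests: "\<And>j. (\<integral>x. clip (g j x) * k x \<partial>P) \<le> c"
  shows "(\<integral>x. \<bar>k x\<bar> \<partial>P) \<le> c"
proof -
  interpret finite_measure P by (rule P)
  have [measurable]: "k \<in> borel_measurable P" "g i \<in> borel_measurable P" for i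
    using k g by auto
  have sgn_int: "integrable P (\<lambda>x. sgn (k x))"
    by (rule integrable_const_bound[of _ 1]) (auto simp: sgn_if)
  have "\<exists>i. (\<integral>x. \<bar>sgn (k x) - g i x\<bar> \<partial>P) < (1 / 2) ^ n" for n
    by (rule dense[OF sgn_int]) simp
  then obtain j where j: "\<And>n. (\<integral>x. \<bar>sgn (k x) - g (j n) x\<bar> \<partial>P) < (1 / 2) ^ n"
    by metis
  have "AE x in P. (\<lambda>n. g (j n) x) \<longlonglongrightarrow> sgn (k x)"
    using j by (intro AE_LIMSEQ_of_fast_L1 sgn_int g) (rule less_imp_le)
  then have "AE x in P. (\<lambda>n. clip (g (j n) x) * k x) \<longlonglongrightarrow> \<bar>k x\<bar>"
  proof eventually_elim
    case (elim x)
    then have "(\<lambda>n. clip (g (j n) x) * k x) \<longlonglongrightarrow> clip (sgn (k x)) * k x"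
      by (intro tendsto_intros tendsto_clip)
    then show ?case
      by (simp add: clip_sgn abs_sgn mult.commute)
  qed
  then have "(\<lambda>n. \<integral>x. clip (g (j n) x) * k x \<partial>P) \<longlonglongrightarrow> (\<integral>x. \<bar>k x\<bar> \<partial>P)"
    by (intro integral_dominated_convergence[where w = "\<lambda>x. \<bar>k x\<bar>"])
       (use k abs_clip_le in \<open>auto simp: abs_mult mult_left_le_one_le\<close>)
  then show ?thesis
    by (rule LIMSEQ_le_const2) (use tests in auto)
qed

section \<open>Measurable selection of densities\<close>

text \<open>
  A density is determined only almost everywhere; this one is real-valued and nonnegative at every
  point, so that it can be compared with the dense sequence in \<open>L\<^sup>1\<close>.
\<close>

lemma obtain_integrable_density:
  assumes "prob_space P" "prob_space N" "sets N = sets P" "absolutely_continuous P N"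
  obtains D :: "'a \<Rightarrow> real" where "integrable P D" "\<And>x. 0 \<le> D x" "N = density P (\<lambda>x. ennreal (D x))"
proof -
  interpret P: prob_space P by fact
  interpret N: prob_space N by fact
  obtain D where D: "D \<in> borel_measurable P" "AE x in P. RN_deriv P N x = ennreal (D x)" "\<And>x. 0 \<le> D x"
    using P.real_RN_deriv[OF N.finite_measure_axioms assms(4,3)] by metis
  have "N = density P (RN_deriv P N)"
    using P.density_RN_deriv[OF assms(4,3)] by simp
  also have "\<dots> = density P (\<lambda>x. ennreal (D x))"
    using D by (intro density_cong) auto
  finally have N: "N = density P (\<lambda>x. ennreal (D x))" .
  have "(\<integral>\<^sup>+x. ennreal (D x) \<partial>P) = emeasure N (space P)"
    using D(1) by (subst N) (auto simp: emeasure_density cong: nn_integral_cong)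
  also have "\<dots> < \<infinity>"
    by (simp add: N.emeasure_eq_measure)
  finally have "integrable P D"
    using D by (intro integrableI_nonneg) auto
  with D N show ?thesis
    by (intro that)
qed

theorem theorem1p1:
  fixes M P :: "'a measure" and K :: "'a \<Rightarrow> 'a measure"
  assumes luzin: "luzin_space TYPE('b) M"
    and P_prob: "prob_space P"
    and P_sets: "sets P = sets M"
    and K_prob: "\<And>\<mu>. \<mu> \<in> space M \<Longrightarrow> prob_space (K \<mu>)"
    and K_sets: "\<And>\<mu>. \<mu> \<in> space M \<Longrightarrow> sets (K \<mu>) = sets M"
    and K_measurable: "\<And>C. C \<in> sets M \<Longrightarrow> (\<lambda>\<mu>. measure (K \<mu>) C) \<in> borel_measurable M"
    and K_ac: "\<And>\<mu>. \<mu> \<in> space M \<Longrightarrow> absolutely_continuous P (K \<mu>)"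
  shows "\<exists>f. RN_version M P K f"
proof -
  interpret P: prob_space P by (rule P_prob)
  note [measurable_cong] = P_sets
  have space_P: "space P = space M"
    using P_sets by (rule sets_eq_imp_space_eq)

  obtain E where E: "countable E" "E \<subseteq> Pow (space P)" "sets P = sigma_sets (space P) E"
    using luzin_space_countably_generated[OF luzin] P_sets space_P by metis
  obtain g :: "nat \<Rightarrow> 'a \<Rightarrow> real" where g: "\<And>i. integrable P (g i)"
    and dense: "\<And>h e. integrable P h \<Longrightarrow> e > 0 \<Longrightarrow> \<exists>i. (\<integral>x. \<bar>h x - g i x\<bar> \<partial>P) < e"
    using L1_dense_sequence[OF P.finite_measure_axioms E] by metis
  have g_P: "g i \<in> borel_measurable P" for i
    using g by auto
  have g_M [measurable]: "g i \<in> borel_measurable M" for i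
    using g_P measurable_cong_sets[OF P_sets refl] by blast

  have kernel: "K \<in> measurable M (subprob_algebra M)"
  proof (rule measurable_subprob_algebra)
    fix C assume C: "C \<in> sets M"
    have "(\<lambda>\<mu>. ennreal (measure (K \<mu>) C)) \<in> borel_measurable M"
      using K_measurable[OF C] by simp
    moreover have "emeasure (K \<mu>) C = ennreal (measure (K \<mu>) C)" if "\<mu> \<in> space M" for \<mu>
      using K_prob[OF that] by (simp add: prob_space.finite_measure finite_measure.emeasure_eq_measure)
    ultimately show "(\<lambda>\<mu>. emeasure (K \<mu>) C) \<in> borel_measurable M"
      by (simp cong: measurable_cong)
  qed (simp_all add: K_prob K_sets prob_space_imp_subprob_space)

  \<comment> \<open>By duality this says that \<open>g i\<close> is within \<open>2\<^sup>-\<^sup>n\<close> of the density of \<open>K \<mu>\<close> in \<open>L\<^sup>1(P)\<close>, but it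
    mentions only the kernel, so that it is measurable in \<open>\<mu>\<close>.\<close>
  define close where "close n i \<mu> \<longleftrightarrow>
    (\<forall>j. (\<integral>x. clip (g j x) \<partial>K \<mu>) - (\<integral>x. clip (g j x) * g i x \<partial>P) \<le> (1 / 2) ^ n)" for n i :: nat and \<mu>
  define index where "index n \<mu> = (LEAST i. close n i \<mu>)" for n \<mu>

  have test_measurable [measurable]: "(\<lambda>\<mu>. \<integral>x. clip (g j x) \<partial>K \<mu>) \<in> borel_measurable M" for j
    by (rule measurable_compose[OF kernel integral_measurable_subprob_algebra]) simp
  have index_measurable [measurable]: "index n \<in> measurable M (count_space UNIV)" for n
    unfolding index_def close_def by measurable

  define u where "u n z = g (index n (fst z)) (snd z)" for n and z :: "'a \<times> 'a"
  have u_measurable [measurable]: "u n \<in> borel_measurable (M \<Otimes>\<^sub>M M)" for n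
    unfolding u_def
    by (rule measurable_compose_countable[where f = "\<lambda>i z. g i (snd z)"]) measurable
  \<comment> \<open>The value of \<open>lim\<close> at points of divergence is unspecified; the absolute value keeps \<open>f\<close>
    nonnegative there as well.\<close>
  define f where "f z = \<bar>lim (\<lambda>n. u n z)\<bar>" for z
  have f_measurable [measurable]: "f \<in> borel_measurable (M \<Otimes>\<^sub>M M)"
    unfolding f_def by measurable

  have "emeasure (K \<mu>) A = (\<integral>\<^sup>+\<nu>\<in>A. ennreal (f (\<mu>, \<nu>)) \<partial>P)" if \<mu>: "\<mu> \<in> space M" and A: "A \<in> sets M" for \<mu> A
  proof -
    obtain h :: "'a \<Rightarrow> real" where h: "integrable P h" "\<And>x. 0 \<le> h x"
        and K_h: "K \<mu> = density P (\<lambda>x. ennreal (h x))"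
      using obtain_integrable_density[OF P_prob K_prob[OF \<mu>] _ K_ac[OF \<mu>]] K_sets[OF \<mu>] P_sets by metis
    have test: "(\<integral>x. clip (g j x) \<partial>K \<mu>) - (\<integral>x. clip (g j x) * g i x \<partial>P)
        = (\<integral>x. clip (g j x) * (h x - g i x) \<partial>P)" for i j
    proof -
      have "(\<integral>x. clip (g j x) \<partial>K \<mu>) = (\<integral>x. clip (g j x) * h x \<partial>P)"
        unfolding K_h using h g_P by (subst integral_density) (auto simp: mult.commute)
      then show ?thesis
        using integrable_clip_mult[OF h(1) g_P, of j] integrable_clip_mult[OF g g_P, of j i]
        by (simp add: right_diff_distrib)
    qed
    have ex_close: "\<exists>i. close n i \<mu>" for n
    proof -
      obtain i where i: "(\<integral>x. \<bar>h x - g i x\<bar> \<partial>P) < (1 / 2) ^ n"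
        using dense[OF h(1), of "(1 / 2) ^ n"] by auto
      have "(\<integral>x. clip (g j x) * (h x - g i x) \<partial>P) \<le> (\<integral>x. \<bar>h x - g i x\<bar> \<partial>P)" for j
      proof (rule integral_mono)
        fix x
        have "clip (g j x) * (h x - g i x) \<le> \<bar>clip (g j x)\<bar> * \<bar>h x - g i x\<bar>"
          by (metis abs_ge_self abs_mult)
        also have "\<dots> \<le> \<bar>h x - g i x\<bar>"
          by (intro mult_left_le_one_le) (auto simp: abs_clip_le)
        finally show "clip (g j x) * (h x - g i x) \<le> \<bar>h x - g i x\<bar>" .
      qed (use h(1) g g_P in \<open>auto intro!: integrable_clip_mult\<close>)
      then have "close n i \<mu>"
        unfolding close_def test using i by (meson less_imp_le order_trans)
      then show ?thesis ..
    qed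
    have index_close: "close n (index n \<mu>) \<mu>" for n
      unfolding index_def using ex_close by (rule LeastI_ex)
    have fast: "(\<integral>x. \<bar>h x - u n (\<mu>, x)\<bar> \<partial>P) \<le> (1 / 2) ^ n" for n
      using index_close[of n] h(1) g unfolding close_def test u_def fst_conv snd_conv
      by (intro L1_norm_le_by_tests[OF P.finite_measure_axioms g dense]) auto
    have "AE x in P. (\<lambda>n. u n (\<mu>, x)) \<longlonglongrightarrow> h x"
      by (rule AE_LIMSEQ_of_fast_L1[OF h(1) _ fast]) (simp add: u_def g)
    then have "AE x in P. f (\<mu>, x) = h x"
      by eventually_elim (use h(2) in \<open>simp add: f_def limI\<close>)
    then have "(\<integral>\<^sup>+\<nu>\<in>A. ennreal (f (\<mu>, \<nu>)) \<partial>P) = (\<integral>\<^sup>+\<nu>\<in>A. ennreal (h \<nu>) \<partial>P)"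
      by (intro nn_integral_cong_AE) auto
    also have "\<dots> = emeasure (K \<mu>) A"
      unfolding K_h using h(1) A P_sets by (subst emeasure_density) auto
    finally show ?thesis ..
  qed
  then have "RN_version M P K f"
    unfolding RN_version_def by (auto simp: f_def[symmetric] intro: f_measurable) (simp add: f_def)
  then show ?thesis
    by (rule exI[of _ f])
qed

end
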